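(* Let $C$ be a smooth complex plane quartic curve which is a smooth member of Ciani's pencil, and let $\mathcal{L}$ be the arrangement of the $28$ bitangent lines to $C$. Then $\mathcal{L}$ has at least $9$ quadruple intersection points.
   Context: Ciani's pencil is the family of plane quartics $Q_\lambda:\ x^4 + y^4 + z^4 + \lambda(x^2y^2 + x^2z^2 + y^2z^2)=0$ in $\mathbb{P}^2_{\mathbb{C}}$, with $\lambda\in\mathbb{C}$. A bitangent of a smooth plane quartic is a line tangent to the curve at two points, which are allowed to coincide, i.e. the line cuts out a divisor $2P+2P'$ on the curve, with $P=P'$ allowed; a smooth complex plane quartic has exactly $28$ bitangents in this sense. A quadruple point of a line arrangement is a point lying on exactly four of the lines. *)

theory Defs
  imports "HOL-Analysis.Analysis" "HOL-Computational_Algebra.Polynomial"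
begin

text \<open>
  The complex projective plane is the projectivization of \<^typ>\<open>complex^3\<close>: points and lines are
  the complex linear subspaces of dimension 1 and 2, incidence is inclusion. Note that
  \<^const>\<open>vec.subspace\<close>, \<^const>\<open>vec.dim\<close> and \<^const>\<open>vec.span\<close> refer to the complex vector space structure
  (the unqualified constants would be the real ones).
\<close>

definition proj_point :: "(complex^3) set \<Rightarrow> bool" where
  "proj_point P \<longleftrightarrow> vec.subspace P \<and> vec.dim P = 1"

definition proj_line :: "(complex^3) set \<Rightarrow> bool" where
  "proj_line L \<longleftrightarrow> vec.subspace L \<and> vec.dim L = 2"

text \<open>
  A plane curve is given by its defining form, viewed as a polynomial function on \<^typ>\<open>complex^3\<close>.
  In this way multiplicities are retained: the double conic occurring in the pencil below is not smooth.
\<close>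

definition partial_deriv :: "(complex^3 \<Rightarrow> complex) \<Rightarrow> 3 \<Rightarrow> complex^3 \<Rightarrow> complex" where
  "partial_deriv F i v = deriv (\<lambda>t. F (v + axis i t)) 0"

definition smooth_plane_curve :: "(complex^3 \<Rightarrow> complex) \<Rightarrow> bool" where
  "smooth_plane_curve F \<longleftrightarrow> (\<forall>v. v \<noteq> 0 \<and> F v = 0 \<longrightarrow> (\<exists>i. partial_deriv F i v \<noteq> 0))"

definition ciani_quartic :: "complex \<Rightarrow> complex^3 \<Rightarrow> complex" where
  "ciani_quartic l v =
     (v$1)^4 + (v$2)^4 + (v$3)^4
     + l * ((v$1)^2 * (v$2)^2 + (v$1)^2 * (v$3)^2 + (v$2)^2 * (v$3)^2)"

text \<open>
  The line \<open>L\<close> is not a component of the curve \<open>F = 0\<close>, and meets it at the point \<open>P\<close> of \<open>L\<close> with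
  intersection multiplicity \<open>n\<close> (where 0 means that \<open>P\<close> is not on the curve): if \<open>P\<close> is spanned by
  \<open>p\<close> and \<open>L\<close> by \<open>p, q\<close>, then \<open>t\<close> is a local parameter of \<open>L\<close> at \<open>P\<close> via \<open>t \<mapsto> p + t q\<close>, and \<open>n\<close> is
  the order of vanishing at 0 of the restriction of \<open>F\<close>. For a form \<open>F\<close>, this does not depend on
  the choice of \<open>p\<close> and \<open>q\<close>.
\<close>

definition has_intersection_mult ::
    "(complex^3 \<Rightarrow> complex) \<Rightarrow> (complex^3) set \<Rightarrow> (complex^3) set \<Rightarrow> nat \<Rightarrow> bool" where
  "has_intersection_mult F L P n \<longleftrightarrow>
     (\<exists>p q r. P = vec.span {p} \<and> L = vec.span {p, q} \<and>
        (\<forall>t. poly r t = F (p + t *s q)) \<and> r \<noteq> 0 \<and> order 0 r = n)"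

text \<open>The divisor cut out on the curve is \<open>2P + 2P'\<close>, where \<open>P = P'\<close> is allowed.\<close>

definition bitangent :: "(complex^3 \<Rightarrow> complex) \<Rightarrow> (complex^3) set \<Rightarrow> bool" where
  "bitangent F L \<longleftrightarrow> proj_line L \<and>
     (\<exists>P P'. proj_point P \<and> P \<subseteq> L \<and> proj_point P' \<and> P' \<subseteq> L \<and>
        (\<forall>Q. proj_point Q \<and> Q \<subseteq> L \<longrightarrow>
           has_intersection_mult F L Q ((if Q = P then 2 else 0) + (if Q = P' then 2 else 0))))"

definition quadruple_point :: "(complex^3) set set \<Rightarrow> (complex^3) set \<Rightarrow> bool" where
  "quadruple_point A P \<longleftrightarrow> proj_point P \<and> card {L \<in> A. P \<subseteq> L} = 4"

end

theory Submission
  imports Defs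
begin

text \<open>
  The nine points are the centres \<open>e\<^sub>i\<close> and \<open>e\<^sub>i \<plusminus> e\<^sub>j\<close> of the nine involutions in the group \<open>S\<^sub>4\<close> of
  coordinate permutations and sign changes, which acts on every member of the pencil. In coordinates
  \<open>(x, y, z)\<close> adapted to such an involution, with centre \<open>(1, 0, 0)\<close>, the quartic is
  \<open>A x\<^sup>4 + q(y, z) x\<^sup>2 + r(y, z)\<close>. Its restriction to a line through the centre is a quadratic
  polynomial in \<open>x\<^sup>2\<close>, so the line is a bitangent iff \<open>q\<^sup>2 - 4 A r\<close> vanishes in its direction. This binary
  form is quadratic in \<open>y\<^sup>2\<close> and \<open>z\<^sup>2\<close>, and it has four distinct zeros unless \<open>l\<close> is one of the
  singular parameters \<open>- 1, 2, - 2\<close>.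
\<close>

section \<open>Points and lines of the projective plane as spans\<close>

lemma in_span_pair_iff:
  fixes v p q :: "complex^3"
  shows "v \<in> vec.span {p, q} \<longleftrightarrow> (\<exists>x s. v = x *s p + s *s q)"
  by (auto simp: vec.span_insert vec.span_singleton algebra_simps)

lemma span_pair_scale:
  fixes p w :: "complex^3"
  assumes "c \<noteq> 0"
  shows "vec.span {p, c *s w} = vec.span {p, w}"
proof -
  have "w = (1 / c) *s (c *s w)" using assms by simp
  then have "w \<in> vec.span {p, c *s w}" by (metis vec.span_base vec.span_scale insertI1 insertI2)
  moreover have "c *s w \<in> vec.span {p, w}" by (simp add: vec.span_base vec.span_scale)
  ultimately show ?thesis by (simp add: vec.span_eq vec.span_base)
qed

lemma span_singleton_eq_iff:
  fixes p q :: "complex^3"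
  assumes "q \<noteq> 0"
  shows "vec.span {p} = vec.span {q} \<longleftrightarrow> (\<exists>c. c \<noteq> 0 \<and> p = c *s q)"
proof
  assume eq: "vec.span {p} = vec.span {q}"
  have "p \<in> vec.span {q}" "q \<in> vec.span {p}"
    using eq vec.span_base[of p "{p}"] vec.span_base[of q "{q}"] by auto
  then show "\<exists>c. c \<noteq> 0 \<and> p = c *s q"
    using assms by (auto simp: vec.span_singleton)
next
  assume "\<exists>c. c \<noteq> 0 \<and> p = c *s q"
  then obtain c where c: "c \<noteq> 0" "p = c *s q" by blast
  then have "q = (1 / c) *s p" by simp
  then have "q \<in> vec.span {p}" by (metis vec.span_base vec.span_scale insertI1)
  moreover have "p \<in> vec.span {q}" using c by (metis vec.span_base vec.span_scale insertI1)
  ultimately show "vec.span {p} = vec.span {q}"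
    by (simp add: vec.span_eq)
qed

lemma proj_point_span:
  fixes p :: "complex^3"
  shows "p \<noteq> 0 \<Longrightarrow> proj_point (vec.span {p})"
  unfolding proj_point_def
  using vec.dim_eq_card_independent[of "{p}"] by (simp add: vec.dependent_single)

lemma proj_point_in_spanE:
  assumes "proj_point Q" "Q \<subseteq> vec.span {p, w}"
  obtains x s where "Q = vec.span {x *s p + s *s w}" "x *s p + s *s w \<noteq> 0"
proof -
  obtain B where B: "B \<subseteq> Q" "vec.independent B" "Q = vec.span B" "card B = 1"
    using assms(1) vec.basis_exists[of Q] vec.span_minimal unfolding proj_point_def
    by (metis subset_antisym)
  then obtain v where v: "B = {v}" by (meson card_1_singletonE)
  moreover have "v \<noteq> 0" using B v by (auto simp: vec.dependent_single)
  moreover have "v \<in> vec.span {p, w}" using assms(2) B(1) v by auto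
  then obtain x s where "v = x *s p + s *s w" unfolding in_span_pair_iff by blast
  ultimately show thesis using B that by blast
qed

section \<open>Restriction of the form to one line through the centre \<open>p\<close>\<close>

locale biquadratic_line =
  fixes F :: "complex^3 \<Rightarrow> complex" and p w :: "complex^3" and A B C :: complex
  assumes indep: "x *s p + s *s w = 0 \<Longrightarrow> x = 0 \<and> s = 0"
    and form: "F (x *s p + s *s w) = A * x^4 + B * x^2 * s^2 + C * s^4"
    and lead: "A \<noteq> 0"
begin

lemma coords_eq: "x *s p + s *s w = x' *s p + s' *s w \<longleftrightarrow> x = x' \<and> s = s'"
  using indep[of "x - x'" "s - s'"] by (auto simp: algebra_simps)

lemma p_nonzero: "p \<noteq> 0"
  using indep[of 1 0] by auto

lemma span_affine_point: "vec.span {u *s p + w} \<subseteq> vec.span {p, w}"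
  by (intro vec.span_minimal) (simp_all add: vec.span_add vec.span_scale vec.span_base)

lemma proj_line_span: "proj_line (vec.span {p, w})"
proof -
  have "w \<noteq> 0" using indep[of 0 1] by auto
  moreover have "p \<notin> vec.span {w}"
  proof
    assume "p \<in> vec.span {w}"
    then obtain c where "p = c *s w" by (auto simp: vec.span_singleton)
    then show False using indep[of 1 "- c"] by simp
  qed
  moreover from this have "p \<noteq> w" using vec.span_base[of w "{w}"] by auto
  ultimately have "vec.independent {p, w}"
    by (simp add: vec.independent_insert vec.dependent_single)
  then show ?thesis
    unfolding proj_line_def using vec.dim_eq_card_independent[of "{p, w}"] \<open>p \<noteq> w\<close> by simp
qed

text \<open>The multiplicity is witnessed by some unknown spanning vectors and polynomial
  \<open>r\<close>. Since \<open>n\<close> is neither 0 (the point is on the curve) nor 1,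
  \<open>r\<close> vanishes doubly at 0. Its derivative there is, up to a nonzero factor, the
  derivative of the binary form at \<open>(x, 1)\<close> in a direction transversal to the point, so
  the partial derivative along \<open>p\<close> has to vanish.\<close>

lemma simple_roots_excluded:
  assumes mult: "has_intersection_mult F (vec.span {p, w}) (vec.span {x *s p + w}) n"
    and n: "n \<noteq> 1" and root: "A * x^4 + B * x^2 + C = 0"
  shows "4 * A * x^3 + 2 * B * x = 0"
proof -
  obtain p' q' r where r: "vec.span {x *s p + w} = vec.span {p'}" "vec.span {p, w} = vec.span {p', q'}"
      "\<And>t. poly r t = F (p' + t *s q')" "r \<noteq> 0" "order 0 r = n"
    using mult unfolding has_intersection_mult_def by blast
  have "x *s p + w \<noteq> 0" using indep[of x 1] by auto
  then obtain c where c: "c \<noteq> 0" "p' = c *s (x *s p + w)"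
    using span_singleton_eq_iff r(1) by metis
  have "q' \<in> vec.span {p, w}" unfolding r(2) by (simp add: vec.span_base)
  then obtain d e where q': "q' = d *s p + e *s w" unfolding in_span_pair_iff by blast
  \<comment> \<open>\<open>d - e * x\<close> is the determinant of the directions
    \<open>(x, 1)\<close> and \<open>(d, e)\<close>. It is nonzero because \<open>p'\<close> and
    \<open>q'\<close> span the whole line, in particular \<open>p\<close>.\<close>
  have "p \<in> vec.span {p', q'}" using r(2) vec.span_base[of p "{p, w}"] by auto
  then obtain y s where "p = y *s p' + s *s q'" by (auto simp: in_span_pair_iff)
  then have "1 *s p + 0 *s w = (y * c * x + s * d) *s p + (y * c + s * e) *s w"
    using c q' by (simp add: algebra_simps)
  then have ys: "1 = y * c * x + s * d" "0 = y * c + s * e" by (auto simp only: coords_eq)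
  then have "1 = s * (d - e * x)" by algebra
  then have dex: "d - e * x \<noteq> 0" by auto
  have poly_r: "poly r t = A * (c * x + t * d)^4 + B * (c * x + t * d)^2 * (c + t * e)^2 + C * (c + t * e)^4" for t
  proof -
    have "p' + t *s q' = (c * x + t * d) *s p + (c + t * e) *s w"
      using c q' by (simp add: algebra_simps)
    then show ?thesis using r(3) form by metis
  qed
  have "poly r 0 = c^4 * (A * x^4 + B * x^2 + C)" by (simp add: poly_r algebra_simps)
  then have "poly r 0 = 0" using root by simp
  then have "n \<noteq> 0" using r(4,5) order_root by metis
  then have "2 \<le> order 0 r" using n r(5) by simp
  then have "[:0, 1:]^2 dvd [:0, 1 :: complex:]^order 0 r" by (rule le_imp_power_dvd)
  also have "[:0, 1:]^order 0 r dvd r" using order_1[of 0 r] by simp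
  finally have "[:0, 1:]^2 dvd r" .
  then obtain k where "r = [:0, 1:]^2 * k" by (elim dvdE)
  then have "poly (pderiv r) 0 = 0"
    by (simp add: pderiv_mult power2_eq_square pderiv_pCons)
  then have "(poly r has_field_derivative 0) (at 0)"
    using poly_DERIV[of r 0] by simp
  moreover have "(poly r has_field_derivative
      c^3 * (4 * A * x^3 * d + 2 * B * x * d + 2 * B * x^2 * e + 4 * C * e)) (at 0)"
    unfolding poly_r[abs_def]
    by (auto intro!: derivative_eq_intros simp: algebra_simps power2_eq_square power3_eq_cube)
  ultimately have "c^3 * (4 * A * x^3 * d + 2 * B * x * d + 2 * B * x^2 * e + 4 * C * e) = 0"
    using DERIV_unique by blast
  then have "4 * A * x^3 * d + 2 * B * x * d + 2 * B * x^2 * e + 4 * C * e = 0"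
    using c by simp
  \<comment> \<open>Euler's relation at the root \<open>x\<close> eliminates \<open>C\<close>.\<close>
  then have "(d - e * x) * (4 * A * x^3 + 2 * B * x) = 0"
    using root by algebra
  then show ?thesis using dex by simp
qed

text \<open>With vanishing discriminant the restriction is \<open>A * (x^2 - e^2 * s^2)^2\<close>,
  so the contact points are spanned by \<open>e *s p + w\<close> and \<open>- e *s p + w\<close>.
  They coincide when \<open>e = 0\<close>, where the line has fourfold contact.\<close>

lemma square_imp_bitangent:
  assumes "B^2 = 4 * A * C"
  shows "bitangent F (vec.span {p, w})"
proof -
  define e where "e = csqrt (- B / (2 * A))"
  have e2: "e^2 = - B / (2 * A)" by (simp add: e_def)
  have B: "B = - 2 * A * e^2" using lead by (simp add: e2)
  have "4 * A * C = 4 * A * (A * e^4)" using assms B by algebra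
  then have C: "C = A * e^4" using lead by simp
  have fact: "F (x *s p + s *s w) = A * (x - e * s)^2 * (x + e * s)^2" for x s
    unfolding form B C by algebra
  \<comment> \<open>Affine chart of the line: the \<open>P u\<close> are all of its points except
    \<open>vec.span {p}\<close>, the point at infinity.\<close>
  define P where "P u = vec.span {u *s p + w}" for u
  have nz: "u *s p + w \<noteq> 0" for u using indep[of u 1] by auto
  have P_eq: "P u = P v \<longleftrightarrow> u = v" for u v
  proof
    assume "P u = P v"
    then obtain c where "u *s p + w = c *s (v *s p + w)"
      using span_singleton_eq_iff nz unfolding P_def by metis
    then have "u *s p + 1 *s w = (c * v) *s p + c *s w" by (simp add: algebra_simps)
    then show "u = v" unfolding coords_eq by simp
  qed simp
  have P_ne: "vec.span {p} \<noteq> P u" for u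
  proof
    assume "vec.span {p} = P u"
    then obtain c where "c \<noteq> 0" "p = c *s (u *s p + w)"
      using span_singleton_eq_iff nz unfolding P_def by metis
    then have "1 *s p + 0 *s w = (c * u) *s p + c *s w" "c \<noteq> 0" by (simp_all add: algebra_simps)
    then show False by (auto simp only: coords_eq)
  qed
  have P_sub: "P u \<subseteq> vec.span {p, w}" for u
    unfolding P_def by (rule span_affine_point)
  have P_point: "proj_point (P u)" for u
    unfolding P_def by (rule proj_point_span[OF nz])
  have mult: "has_intersection_mult F (vec.span {p, w}) Q
      ((if Q = P e then 2 else 0) + (if Q = P (- e) then 2 else 0))"
    if Q: "proj_point Q" "Q \<subseteq> vec.span {p, w}" for Q
  proof -
    obtain x s where xs: "Q = vec.span {x *s p + s *s w}" "x *s p + s *s w \<noteq> 0"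
      using proj_point_in_spanE Q by metis
    show ?thesis
    proof (cases "s = 0")
      case True
      then have x: "x \<noteq> 0" using xs by auto
      then have Qp: "Q = vec.span {p}"
        unfolding xs(1) using True p_nonzero by (subst span_singleton_eq_iff) auto
      \<comment> \<open>At infinity the parametrization is \<open>p + t *s w\<close>. The value at
        \<open>t = 0\<close> is \<open>A\<close>, so the centre is off the curve and the
        multiplicity is 0.\<close>
      let ?r = "smult A ([:1, - e:]^2 * [:1, e:]^2)"
      have r: "poly ?r t = F (p + t *s w)" for t
        using fact[of 1 t] by (simp add: algebra_simps)
      have "poly ?r 0 \<noteq> 0" using lead by simp
      then have "?r \<noteq> 0" "order 0 ?r = 0" by (metis poly_0, metis order_root)
      then show ?thesis
        unfolding has_intersection_mult_def using Qp r P_ne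
        by (intro exI[of _ p] exI[of _ w] exI[of _ ?r]) simp
    next
      case False
      define u where "u = x / s"
      have "x *s p + s *s w = s *s (u *s p + w)"
        using False by (simp add: u_def algebra_simps)
      then have Qu: "Q = P u"
        unfolding xs(1) P_def using False nz by (subst span_singleton_eq_iff) auto
      \<comment> \<open>At a finite point the line is parametrized in the direction of
        \<open>p\<close>. Each squared factor contributes 2 exactly when \<open>u\<close> is its
        root; for \<open>u = e = 0\<close> both do, which gives the 4 that the definition asks for
        when the contact points agree.\<close>
      let ?r = "smult A ([:u - e, 1:]^2 * [:u + e, 1:]^2)"
      have r: "poly ?r t = F ((u *s p + w) + t *s p)" for t
        using fact[of "u + t" 1] by (simp add: algebra_simps)
      have nz': "?r \<noteq> 0" using lead by simp
      have ord: "order 0 ([:a, 1:]^2) = (if a = 0 then 2 else 0)" for a :: complex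
        using order_power_n_n[of 0 2] by (auto simp: order_0I)
      have "order 0 ?r = order 0 ([:u - e, 1:]^2) + order 0 ([:u + e, 1:]^2)"
        using lead by (subst order_smult) (auto intro!: order_mult)
      then have "order 0 ?r = (if Q = P e then 2 else 0) + (if Q = P (- e) then 2 else 0)"
        unfolding ord Qu P_eq by (simp add: eq_neg_iff_add_eq_0)
      moreover have "vec.span {p, w} = vec.span {u *s p + w, p}"
      proof -
        have "w = (- u) *s p + 1 *s (u *s p + w)" by (simp add: algebra_simps)
        then have "w \<in> vec.span {p, u *s p + w}" unfolding in_span_pair_iff by blast
        moreover have "u *s p + w \<in> vec.span {p, w}"
          by (simp add: vec.span_add vec.span_scale vec.span_base)
        ultimately show ?thesis
          by (simp add: vec.span_eq vec.span_base insert_commute)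
      qed
      ultimately show ?thesis
        unfolding has_intersection_mult_def using Qu r nz' P_def
        by (intro exI[of _ "u *s p + w"] exI[of _ p] exI[of _ ?r]) simp
    qed
  qed
  then show ?thesis
    unfolding bitangent_def using proj_line_span P_point P_sub by blast
qed

text \<open>A bitangent has only multiplicities 0, 2 and 4. A nonzero discriminant would yield a
  simple root \<open>x\<close> of the restriction, hence a point of multiplicity 1.\<close>

lemma bitangent_imp_square:
  assumes bit: "bitangent F (vec.span {p, w})"
  shows "B^2 = 4 * A * C"
proof (rule ccontr)
  assume neq: "B^2 \<noteq> 4 * A * C"
  \<comment> \<open>The root in \<open>x^2\<close> must be nonzero: the derivative
    \<open>2 * x * (2 * A * X + B)\<close> vanishes at \<open>x = 0\<close> whatever the
    discriminant is. For \<open>C = 0\<close> the root 0 is avoided by taking the other one,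
    \<open>- B / A\<close>.\<close>
  obtain X where X: "A * X^2 + B * X + C = 0" "X \<noteq> 0"
  proof (cases "C = 0")
    case True
    then have "B \<noteq> 0" using neq by auto
    show thesis
      by (rule that[of "- B / A"]) (use lead True \<open>B \<noteq> 0\<close> in \<open>auto simp: field_simps power2_eq_square\<close>)
  next
    case False
    define X where "X = (- B + csqrt (B^2 - 4 * A * C)) / (2 * A)"
    have "2 * A * X + B = csqrt (B^2 - 4 * A * C)" using lead by (simp add: X_def)
    then have "(2 * A * X + B)^2 = B^2 - 4 * A * C" by simp
    then have "4 * A * (A * X^2 + B * X + C) = 0" by algebra
    then have "A * X^2 + B * X + C = 0" using lead by simp
    with False show thesis by (intro that[of X]) auto
  qed
  define x where "x = csqrt X"
  have x: "x^2 = X" by (simp add: x_def)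
  have root: "A * x^4 + B * x^2 + C = 0" using X(1) x by algebra
  let ?Q = "vec.span {x *s p + w}"
  have "x *s p + w \<noteq> 0" using indep[of x 1] by auto
  then have "proj_point ?Q" by (rule proj_point_span)
  moreover have "?Q \<subseteq> vec.span {p, w}"
    by (rule span_affine_point)
  ultimately obtain P P' where "has_intersection_mult F (vec.span {p, w}) ?Q
      ((if ?Q = P then 2 else 0) + (if ?Q = P' then 2 else 0))"
    using bit unfolding bitangent_def by blast
  then have "4 * A * x^3 + 2 * B * x = 0"
    using root by (intro simple_roots_excluded) (auto split: if_splits)
  then have "x * (2 * A * X + B) = 0" using x by algebra
  then have "2 * A * X + B = 0" using X(2) x by auto
  then have "B^2 = 4 * A * C" using X(1) by algebra
  with neq show False by contradiction
qed

lemma bitangent_iff: "bitangent F (vec.span {p, w}) \<longleftrightarrow> B^2 = 4 * A * C"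
  using bitangent_imp_square square_imp_bitangent by blast

end

section \<open>The pencil of lines through the centre \<open>p\<close>, for a form even in all three
  coordinates\<close>

locale biquadratic_form =
  fixes F :: "complex^3 \<Rightarrow> complex" and p a b :: "complex^3" and A \<alpha> \<beta> \<gamma> \<delta> \<epsilon> :: complex
  assumes indep: "x *s p + y *s a + z *s b = 0 \<Longrightarrow> x = 0 \<and> y = 0 \<and> z = 0"
    and spans: "\<exists>x y z. v = x *s p + y *s a + z *s b"
    and form: "F (x *s p + y *s a + z *s b) =
      A * x^4 + (\<alpha> * y^2 + \<beta> * z^2) * x^2 + (\<gamma> * y^4 + \<delta> * y^2 * z^2 + \<epsilon> * z^4)"
    and lead: "A \<noteq> 0"
begin

lemma biquadratic_line:
  assumes "y \<noteq> 0 \<or> z \<noteq> 0"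
  shows "biquadratic_line F p (y *s a + z *s b) A (\<alpha> * y^2 + \<beta> * z^2)
    (\<gamma> * y^4 + \<delta> * y^2 * z^2 + \<epsilon> * z^4)"
proof
  fix x s :: complex
  have eq: "x *s p + s *s (y *s a + z *s b) = x *s p + (s * y) *s a + (s * z) *s b"
    by (simp add: algebra_simps)
  show "x *s p + s *s (y *s a + z *s b) = 0 \<Longrightarrow> x = 0 \<and> s = 0"
    unfolding eq using indep assms by fastforce
  show "F (x *s p + s *s (y *s a + z *s b)) = A * x^4 + (\<alpha> * y^2 + \<beta> * z^2) * x^2 * s^2
      + (\<gamma> * y^4 + \<delta> * y^2 * z^2 + \<epsilon> * z^4) * s^4"
    unfolding eq form by algebra
qed (rule lead)

text \<open>Subtracting the \<open>p\<close>-component from a vector of \<open>L\<close> outside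
  \<open>vec.span {p}\<close> leaves a direction in the plane of \<open>a\<close> and
  \<open>b\<close>; dimensions then force equality.\<close>

lemma line_through_pE:
  assumes "proj_line L" "vec.span {p} \<subseteq> L"
  obtains y z where "y \<noteq> 0 \<or> z \<noteq> 0" "L = vec.span {p, y *s a + z *s b}"
proof -
  have L: "vec.subspace L" "vec.dim L = 2" using assms(1) by (auto simp: proj_line_def)
  have "p \<in> L" using assms(2) vec.span_base[of p "{p}"] by auto
  have "p \<noteq> 0" using indep[of 1 0 0] by auto
  have "vec.dim (vec.span {p}) = 1" using proj_point_span[OF \<open>p \<noteq> 0\<close>] by (simp add: proj_point_def)
  then obtain v where v: "v \<in> L" "v \<notin> vec.span {p}"
    using L(2) assms(2) by (metis one_eq_numeral_iff semiring_norm(85) subsetI subset_antisym)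
  obtain x y z where xyz: "v = x *s p + y *s a + z *s b" using spans by blast
  let ?w = "y *s a + z *s b"
  have yz: "y \<noteq> 0 \<or> z \<noteq> 0"
    using v(2) xyz by (auto simp: vec.span_singleton)
  have "?w = v - x *s p" using xyz by simp
  then have "?w \<in> L" using L(1) v(1) \<open>p \<in> L\<close> by (metis vec.subspace_diff vec.subspace_scale)
  then have "vec.span {p, ?w} \<subseteq> L" using \<open>p \<in> L\<close> L(1) by (intro vec.span_minimal) auto
  moreover have "vec.dim (vec.span {p, ?w}) = 2"
    using biquadratic_line.proj_line_span[OF biquadratic_line[OF yz]] by (simp add: proj_line_def)
  ultimately have "L = vec.span {p, ?w}"
    using vec.subspace_dim_equal[of "vec.span {p, ?w}" L] L vec.subspace_span by simp
  with yz show thesis by (rule that)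
qed

lemma lines_through_p_inj: "inj (\<lambda>m. vec.span {p, m *s a + b})"
proof (rule injI)
  fix m n
  assume "vec.span {p, m *s a + b} = vec.span {p, n *s a + b}"
  then have "m *s a + b \<in> vec.span {p, n *s a + b}"
    using vec.span_base[of "m *s a + b" "{p, m *s a + b}"] by auto
  then obtain x s where "m *s a + b = x *s p + s *s (n *s a + b)"
    by (auto simp: in_span_pair_iff)
  then have "(- x) *s p + (m - s * n) *s a + (1 - s) *s b = 0"
    by (simp add: algebra_simps)
  then have "m - s * n = 0" "1 - s = 0" using indep by blast+
  then show "m = n" by simp
qed

text \<open>The constants are the coefficients of the discriminant \<open>q^2 - 4 * A * r\<close> as
  a quadratic form in \<open>y^2\<close> and \<open>z^2\<close>. The condition on \<open>a0\<close>
  excludes the direction \<open>z = 0\<close>, so every bitangent through \<open>p\<close> has a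
  slope \<open>m = y / z\<close>. The other two conditions make the four slopes distinct.\<close>

lemma quadruple_point_p:
  fixes a0 b0 c0 :: complex
  defines "a0 \<equiv> \<alpha>^2 - 4 * A * \<gamma>" and "b0 \<equiv> 2 * \<alpha> * \<beta> - 4 * A * \<delta>" and "c0 \<equiv> \<beta>^2 - 4 * A * \<epsilon>"
  assumes nz: "a0 \<noteq> 0" "c0 \<noteq> 0" "b0^2 \<noteq> 4 * a0 * c0"
  shows "quadruple_point {L. bitangent F L} (vec.span {p})"
proof -
  define M where "M = {m. a0 * m^4 + b0 * m^2 + c0 = 0}"
  have disc: "(\<alpha> * y^2 + \<beta> * z^2)^2 = 4 * A * (\<gamma> * y^4 + \<delta> * y^2 * z^2 + \<epsilon> * z^4)
      \<longleftrightarrow> a0 * y^4 + b0 * y^2 * z^2 + c0 * z^4 = 0" for y z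
    unfolding a0_def b0_def c0_def by algebra
  have "{L \<in> {L. bitangent F L}. vec.span {p} \<subseteq> L} = (\<lambda>m. vec.span {p, m *s a + b}) ` M"
  proof (intro equalityI subsetI)
    fix L assume "L \<in> {L \<in> {L. bitangent F L}. vec.span {p} \<subseteq> L}"
    then have L: "bitangent F L" "vec.span {p} \<subseteq> L" by auto
    then obtain y z where yz: "y \<noteq> 0 \<or> z \<noteq> 0" "L = vec.span {p, y *s a + z *s b}"
      using line_through_pE unfolding bitangent_def by metis
    then have eq: "a0 * y^4 + b0 * y^2 * z^2 + c0 * z^4 = 0"
      using L(1) biquadratic_line.bitangent_iff[OF biquadratic_line] disc by blast
    have "z \<noteq> 0" using eq yz(1) nz(1) by auto
    then have "a0 * (y / z)^4 + b0 * (y / z)^2 + c0 = (a0 * y^4 + b0 * y^2 * z^2 + c0 * z^4) / z^4"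
      by (simp add: field_simps power2_eq_square power4_eq_xxxx)
    then have "y / z \<in> M" using eq by (simp add: M_def)
    moreover have "y *s a + z *s b = z *s ((y / z) *s a + b)"
      using \<open>z \<noteq> 0\<close> by (simp add: algebra_simps)
    then have "L = vec.span {p, (y / z) *s a + b}"
      using yz(2) \<open>z \<noteq> 0\<close> span_pair_scale by metis
    ultimately show "L \<in> (\<lambda>m. vec.span {p, m *s a + b}) ` M" by blast
  next
    fix L assume "L \<in> (\<lambda>m. vec.span {p, m *s a + b}) ` M"
    then obtain m where m: "m \<in> M" "L = vec.span {p, m *s a + 1 *s b}" by auto
    then have "bitangent F L"
      using biquadratic_line.bitangent_iff[OF biquadratic_line, of m 1] disc[of m 1] by (simp add: M_def)
    moreover have "vec.span {p} \<subseteq> L" unfolding m(2) by (rule vec.span_mono) auto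
    ultimately show "L \<in> {L \<in> {L. bitangent F L}. vec.span {p} \<subseteq> L}" by simp
  qed
  then have "card {L \<in> {L. bitangent F L}. vec.span {p} \<subseteq> L} = card M"
    using card_image[OF inj_on_subset[OF lines_through_p_inj subset_UNIV]] by simp
  also have "card M = 4"
  proof -
    \<comment> \<open>The slopes are the two square roots of each of the two roots of
      \<open>a0 * X^2 + b0 * X + c0\<close>.\<close>
    define d where "d = csqrt (b0^2 - 4 * a0 * c0)"
    have d: "d \<noteq> 0" "d^2 = b0^2 - 4 * a0 * c0" using nz by (auto simp: d_def)
    define u v where "u = csqrt ((- b0 + d) / (2 * a0))" and "v = csqrt ((- b0 - d) / (2 * a0))"
    have u2: "u^2 = (- b0 + d) / (2 * a0)" and v2: "v^2 = (- b0 - d) / (2 * a0)"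
      by (simp_all add: u_def v_def)
    have sum: "a0 * (u^2 + v^2) = - b0" and diff: "a0 * (u^2 - v^2) = d"
      unfolding u2 v2 using nz(1) by (simp_all add: field_simps)
    \<comment> \<open>The product of the roots comes from their sum and difference:
      \<open>4 * u^2 * v^2 = (u^2 + v^2)^2 - (u^2 - v^2)^2\<close>.\<close>
    have "4 * a0 * (a0 * (u^2 * v^2)) = 4 * a0 * c0" using sum diff d(2) by algebra
    then have prod: "a0 * (u^2 * v^2) = c0" using nz(1) by simp
    have "a0 * m^4 + b0 * m^2 + c0 = a0 * ((m - u) * (m + u) * (m - v) * (m + v))" for m
      using sum prod by algebra
    then have "M = {u, - u, v, - v}" using nz(1) by (auto simp: M_def eq_neg_iff_add_eq_0)
    moreover have "u \<noteq> 0" "v \<noteq> 0" using prod nz(2) by auto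
    moreover have "u \<noteq> v" "u \<noteq> - v" using diff d(1) by auto
    moreover have "- u \<noteq> v" using \<open>u \<noteq> - v\<close> by auto
    ultimately show ?thesis by simp
  qed
  finally show ?thesis
    unfolding quadruple_point_def using proj_point_span[of p] indep[of 1 0 0] by auto
qed

end

section \<open>Three singular members of the pencil\<close>

lemma smooth_ciani_parameter:
  assumes "smooth_plane_curve (ciani_quartic l)"
  shows "l \<noteq> - 1" "l \<noteq> 2" "l \<noteq> - 2"
proof -
  \<comment> \<open>Subtracting \<open>(v$i)^2\<close> from the full sum of squares leaves the other
    two coordinates, so one formula covers all three indices.\<close>
  have deriv: "partial_deriv (ciani_quartic l) i v =
      4 * (v$i)^3 + 2 * l * (v$i) * ((v$1)^2 + (v$2)^2 + (v$3)^2 - (v$i)^2)" for i v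
  proof -
    have "i = 1 \<or> i = 2 \<or> i = 3" by (rule exhaust_3)
    then show ?thesis
      unfolding partial_deriv_def ciani_quartic_def
      by (elim disjE; simp; intro DERIV_imp_deriv)
        (auto intro!: derivative_eq_intros simp: axis_def algebra_simps power2_eq_square power3_eq_cube)
  qed
  have sing: False if "v \<noteq> 0" "ciani_quartic l v = 0"
      "\<forall>i. 4 * (v$i)^3 + 2 * l * (v$i) * ((v$1)^2 + (v$2)^2 + (v$3)^2 - (v$i)^2) = 0" for v
    using assms that unfolding smooth_plane_curve_def deriv by blast
  \<comment> \<open>For \<open>l = - 1\<close> the quartic splits into two conics, both through
    \<open>(1, 1, 1)\<close>.\<close>
  show "l \<noteq> - 1"
    using sing[of "vector [1, 1, 1]"] by (auto simp: ciani_quartic_def vec_eq_iff forall_3)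
  \<comment> \<open>For \<open>l = 2\<close> the quartic is the double conic
    \<open>(x^2 + y^2 + z^2)^2\<close>, singular at each of its points, such as
    \<open>(1, \<i>, 0)\<close>.\<close>
  have "\<i>^3 = - \<i>" "\<i>^4 = 1" by (simp_all add: power3_eq_cube power4_eq_xxxx)
  then show "l \<noteq> 2"
    using sing[of "vector [1, \<i>, 0]"] by (auto simp: ciani_quartic_def vec_eq_iff forall_3)
  \<comment> \<open>For \<open>l = - 2\<close> the quartic is a union of four lines, two of which
    meet at \<open>(1, 1, 0)\<close>.\<close>
  show "l \<noteq> - 2"
    using sing[of "vector [1, 1, 0]"] by (auto simp: ciani_quartic_def vec_eq_iff forall_3)
qed

section \<open>The quartic in coordinates adapted to each of the nine centres\<close>

lemma ciani_quartic_permute: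
  assumes "i \<noteq> j" "i \<noteq> k" "j \<noteq> k"
  shows "ciani_quartic l v = (v$i)^4 + (v$j)^4 + (v$k)^4
    + l * ((v$i)^2 * (v$j)^2 + (v$i)^2 * (v$k)^2 + (v$j)^2 * (v$k)^2)"
  using assms exhaust_3[of i] exhaust_3[of j] exhaust_3[of k]
  by (auto simp: ciani_quartic_def algebra_simps)

lemma vec3_eq_iff_distinct:
  fixes u v :: "complex^3"
  assumes "i \<noteq> j" "i \<noteq> k" "j \<noteq> k"
  shows "u = v \<longleftrightarrow> u$i = v$i \<and> u$j = v$j \<and> u$k = v$k"
  using assms exhaust_3[of i] exhaust_3[of j] exhaust_3[of k]
  by (auto simp: vec_eq_iff forall_3)

text \<open>The involution with this centre changes the sign of coordinate \<open>i\<close>, and the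
  standard coordinates are already adapted. The coefficients of the discriminant form and its own
  discriminant factor into \<open>l - 2\<close>, \<open>l + 2\<close> and
  \<open>l + 1\<close>.\<close>

lemma quadruple_point_vertex:
  fixes i j k :: 3
  assumes ijk: "i \<noteq> j" "i \<noteq> k" "j \<noteq> k" and l: "l \<noteq> - 1" "l \<noteq> 2" "l \<noteq> - 2"
  shows "quadruple_point {L. bitangent (ciani_quartic l) L} (vec.span {axis i 1})"
proof -
  interpret biquadratic_form "ciani_quartic l" "axis i 1" "axis j 1" "axis k 1" 1 l l 1 l 1
  proof
    fix x y z :: complex
    show "x *s axis i 1 + y *s axis j 1 + z *s axis k 1 = 0 \<Longrightarrow> x = 0 \<and> y = 0 \<and> z = 0"
      using ijk by (auto simp: vec3_eq_iff_distinct[OF ijk] axis_def)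
    show "ciani_quartic l (x *s axis i 1 + y *s axis j 1 + z *s axis k 1) =
        1 * x^4 + (l * y^2 + l * z^2) * x^2 + (1 * y^4 + l * y^2 * z^2 + 1 * z^4)"
      unfolding ciani_quartic_permute[OF ijk] using ijk by (simp add: axis_def algebra_simps)
  next
    fix v :: "complex^3"
    have "v = v$i *s axis i 1 + v$j *s axis j 1 + v$k *s axis k 1"
      using ijk by (auto simp: vec3_eq_iff_distinct[OF ijk] axis_def)
    then show "\<exists>x y z. v = x *s axis i 1 + y *s axis j 1 + z *s axis k 1" by blast
  qed simp
  have "l^2 - 4 = (l - 2) * (l + 2)"
    "(2 * l * l - 4 * l)^2 - 4 * (l^2 - 4) * (l^2 - 4) = - 16 * (l - 2)^2 * (l + 1)" by algebra+
  moreover have "l - 2 \<noteq> 0" "l + 2 \<noteq> 0" "l + 1 \<noteq> 0" using l by (simp_all add: eq_neg_iff_add_eq_0)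
  ultimately show ?thesis by (intro quadruple_point_p) auto
qed

text \<open>The involution with this centre is the signed transposition sending \<open>e_i\<close>
  to \<open>- \<sigma> *s e_j\<close> and \<open>e_j\<close> to \<open>- \<sigma> *s e_i\<close>: it
  negates \<open>?p\<close> and fixes \<open>?a\<close> and \<open>e_k\<close>. Both signs give the
  same form, since \<sigma> enters only through its even powers.\<close>

lemma quadruple_point_edge:
  fixes i j k :: 3 and \<sigma> :: complex
  assumes ijk: "i \<noteq> j" "i \<noteq> k" "j \<noteq> k" and l: "l \<noteq> - 1" "l \<noteq> 2" "l \<noteq> - 2" and \<sigma>: "\<sigma>^2 = 1"
  shows "quadruple_point {L. bitangent (ciani_quartic l) L} (vec.span {axis i 1 + \<sigma> *s axis j 1})"
proof -
  let ?p = "axis i 1 + \<sigma> *s axis j 1 :: complex^3" and ?a = "axis i 1 - \<sigma> *s axis j 1 :: complex^3"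
  interpret biquadratic_form "ciani_quartic l" ?p ?a "axis k 1"
    "l + 2" "12 - 2 * l" "2 * l" "l + 2" "2 * l" 1
  proof
    fix x y z :: complex
    have \<sigma>0: "\<sigma> \<noteq> 0" using \<sigma> by auto
    let ?v = "x *s ?p + y *s ?a + z *s axis k 1"
    have v: "?v$i = x + y" "?v$j = \<sigma> * (x - y)" "?v$k = z"
      using ijk by (auto simp: axis_def algebra_simps)
    show "?v = 0 \<Longrightarrow> x = 0 \<and> y = 0 \<and> z = 0"
      unfolding vec3_eq_iff_distinct[OF ijk] v using \<sigma>0 by auto
    have "(\<sigma> * (x - y))^2 = (x - y)^2" "(\<sigma> * (x - y))^4 = (x - y)^4" using \<sigma> by algebra+
    then show "ciani_quartic l ?v = (l + 2) * x^4 + ((12 - 2 * l) * y^2 + 2 * l * z^2) * x^2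
        + ((l + 2) * y^4 + 2 * l * y^2 * z^2 + 1 * z^4)"
      unfolding ciani_quartic_permute[OF ijk] v by algebra
  next
    fix v :: "complex^3"
    have "\<sigma> * \<sigma> = 1" using \<sigma> by (simp add: power2_eq_square)
    \<comment> \<open>As \<sigma> is its own inverse, \<open>x + y = v$i\<close> and
      \<open>x - y = \<sigma> * v$j\<close>, which is solved for the coefficients below.\<close>
    then have "\<sigma> * (\<sigma> * t) = t" for t by (simp flip: mult.assoc)
    then have "v = ((v$i + \<sigma> * v$j) / 2) *s ?p + ((v$i - \<sigma> * v$j) / 2) *s ?a + v$k *s axis k 1"
      using ijk by (auto simp: vec3_eq_iff_distinct[OF ijk] axis_def field_simps)
    then show "\<exists>x y z. v = x *s ?p + y *s ?a + z *s axis k 1" by blast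
  next
    show "l + 2 \<noteq> 0" using l by (simp_all add: eq_neg_iff_add_eq_0)
  qed
  have "(12 - 2 * l)^2 - 4 * (l + 2) * (l + 2) = - 64 * (l - 2)"
    "2 * (12 - 2 * l) * (2 * l) - 4 * (l + 2) * (2 * l) = - 16 * l * (l - 2)"
    "(2 * l)^2 - 4 * (l + 2) * 1 = 4 * (l - 2) * (l + 1)"
    "(- 16 * l * (l - 2))^2 - 4 * (- 64 * (l - 2)) * (4 * (l - 2) * (l + 1)) = 256 * (l - 2)^2 * (l + 2)^2"
    by algebra+
  moreover have "l - 2 \<noteq> 0" "l + 2 \<noteq> 0" "l + 1 \<noteq> 0" using l by (simp_all add: eq_neg_iff_add_eq_0)
  ultimately show ?thesis by (intro quadruple_point_p) auto
qed

text \<open>Each projective point has at most one spanning vector whose first nonzero coordinate is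
  1, because this fixes the scalar. This serves to separate the nine points.\<close>

lemma span_inj_on_normalized:
  "inj_on (\<lambda>v. vec.span {v}) {v :: complex^3. v$1 = 1 \<or> v$1 = 0 \<and> v$2 = 1 \<or> v$1 = 0 \<and> v$2 = 0 \<and> v$3 = 1}"
    (is "inj_on _ ?N")
proof (rule inj_onI)
  fix u v assume uv: "u \<in> ?N" "v \<in> ?N" "vec.span {u} = vec.span {v}"
  have "v \<noteq> 0" using uv(2) by auto
  then obtain c where "c \<noteq> 0" "u = c *s v" using uv(3) by (auto simp: span_singleton_eq_iff)
  then show "u = v" using uv(1,2) by auto
qed

theorem proposition3p8:
  fixes l :: complex
  assumes "smooth_plane_curve (ciani_quartic l)"
  shows "\<exists>S. S \<subseteq> {P. quadruple_point {L. bitangent (ciani_quartic l) L} P} \<and> finite S \<and> card S = 9"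
proof -
  note l = smooth_ciani_parameter[OF assms]
  define E where "E i = (axis i 1 :: complex^3)" for i :: 3
  \<comment> \<open>The redundant factors \<open>1 *s\<close> and \<open>(- 1) *s\<close> give the
    six edge vectors the shape of \<open>edge\<close> below. All nine vectors are
    normalized.\<close>
  define V where "V = {E 1, E 2, E 3, E 1 + 1 *s E 2, E 1 + (- 1) *s E 2, E 1 + 1 *s E 3,
    E 1 + (- 1) *s E 3, E 2 + 1 *s E 3, E 2 + (- 1) *s E 3}"
  have V: "card V = 9"
    unfolding V_def E_def by (simp add: card_insert_if vec_eq_iff forall_3 axis_def)
  have "inj_on (\<lambda>v. vec.span {v}) V"
    by (rule inj_on_subset[OF span_inj_on_normalized]) (auto simp: V_def E_def axis_def)
  then have "card ((\<lambda>v. vec.span {v}) ` V) = 9" using V card_image by metis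
  moreover have "quadruple_point {L. bitangent (ciani_quartic l) L} (vec.span {v})" if "v \<in> V" for v
  proof -
    have vertex: "quadruple_point {L. bitangent (ciani_quartic l) L} (vec.span {E i})" for i
      \<comment> \<open>Arithmetic in the index type is modulo 3, so \<open>i\<close>,
        \<open>i + 1\<close> and \<open>i + 2\<close> are the three indices.\<close>
      using quadruple_point_vertex[OF _ _ _ l, of i "i + 1" "i + 2"] by (simp add: E_def)
    have edge: "quadruple_point {L. bitangent (ciani_quartic l) L} (vec.span {E i + \<sigma> *s E j})"
      if "i \<noteq> j" "\<sigma> = 1 \<or> \<sigma> = - 1" for i j :: 3 and \<sigma>
    proof -
      \<comment> \<open>By counting, two indices do not exhaust the type, which provides the third
        index \<open>k\<close>.\<close>
      have "card {i, j} \<noteq> CARD(3)" using card_length[of "[i, j]"] by simp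
      then have "{i, j} \<noteq> UNIV" by metis
      then obtain k where "k \<noteq> i" "k \<noteq> j" by blast
      then show ?thesis
        using quadruple_point_edge[OF _ _ _ l, of i j k \<sigma>] that by (auto simp: E_def)
    qed
    from that show ?thesis
      unfolding V_def by - (elim insertE emptyE; simp only:; (rule vertex | (rule edge; simp)))
  qed
  moreover have "finite V" by (simp add: V_def)
  ultimately show ?thesis by (intro exI[of _ "(\<lambda>v. vec.span {v}) ` V"]) auto
qed

end
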